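(* Let $P\in\mathbb{H}_{\rm coq}[x]$ be a monic polynomial of degree $n\ge 2$, let $[\![q]\!]$ (with $q=q_0+q_1\mathbf i+q_2\mathbf j+q_3\mathbf k$) be an admissible class of $P$, and let $A+Bx$, with $A,B\in\mathbb{H}_{\rm coq}$, $B=b_0+b_1\mathbf i+b_2\mathbf j+b_3\mathbf k$, be the remainder of the right division of $P(x)$ by the characteristic polynomial $\Psi_{[\![q]\!]}$, i.e. $P(x)=Q(x)\Psi_{[\![q]\!]}(x)+A+Bx$ for some $Q\in\mathbb{H}_{\rm coq}[x]$. Let $Z_{[\![q]\!]}$ denote the set of zeros of $P$ belonging to $[\![q]\!]$. Then: 1. If $B$ is non-singular, then $P$ has an isolated zero in $[\![q]\!]$ and $Z_{[\![q]\!]}=\Big\{-\dfrac{\overline{B}A}{\det(B)}\Big\}$. 2. If $B=0$ and (a) $A\neq 0$, then $Z_{[\![q]\!]}=\emptyset$; (b) $A=0$, then $Z_{[\![q]\!]}=[\![q]\!]$, i.e. $[\![q]\!]$ is a hyperboloidal zero of $P$. 3. If $B\neq 0$ is singular, put $k_1=-\dfrac{b_0b_2+b_1b_3}{b_0^2+b_1^2}$ and $k_2=\dfrac{b_1b_2-b_0b_3}{b_0^2+b_1^2}$. If the equation $A+Bx=0$ (in the unknown $x\in\mathbb{H}_{\rm coq}$) has (a) no solution, then $Z_{[\![q]\!]}=\emptyset$; (b) a real solution $\gamma_0$, then: (i) if $(q_0-\gamma_0)^2=-\mathrm{dv}(q)$, then $$Z_{[\![q]\!]}=\big\{q_0+\beta\mathbf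 i+(k_2\beta+k_1(q_0-\gamma_0))\mathbf j+(-k_1\beta+k_2(q_0-\gamma_0))\mathbf k:\ \beta\in\mathbb{R}\big\},$$ i.e. $Z_{[\![q]\!]}$ is a linear zero of $P$; (ii) if $(q_0-\gamma_0)^2\neq-\mathrm{dv}(q)$, then $Z_{[\![q]\!]}=\emptyset$; (c) a nonreal solution of the form $\gamma=\gamma_0+\gamma_1\mathbf i$ (with $\gamma_0,\gamma_1\in\mathbb{R}$, $\gamma_1\ne0$), then $P$ has an isolated zero in $[\![q]\!]$ and $$Z_{[\![q]\!]}=\big\{q_0+(\beta+\gamma_1)\mathbf i+(k_2\beta+k_1(q_0-\gamma_0))\mathbf j+(-k_1\beta+k_2(q_0-\gamma_0))\mathbf k\big\},$$ with $\beta=\dfrac{\mathrm{dv}(q)+(q_0-\gamma_0)^2-\gamma_1^2}{2\gamma_1}$. The set $Z_{[\![q]\!]}$ is completely characterized in terms of $A$ and $B$ in this way, i.e. the cases listed are exhaustive.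
   Context: $\mathbb{H}_{\rm coq}$ denotes the real algebra of coquaternions (split quaternions): the $4$-dimensional associative real algebra with basis $1,\mathbf i,\mathbf j,\mathbf k$ and multiplication $\mathbf i^2=-1$, $\mathbf j^2=\mathbf k^2=1$, $\mathbf i\mathbf j=-\mathbf j\mathbf i=\mathbf k$. For $q=q_0+q_1\mathbf i+q_2\mathbf j+q_3\mathbf k$: $\mathrm{Re}(q)=q_0$, $\overline q=q_0-q_1\mathbf i-q_2\mathbf j-q_3\mathbf k$, $\det(q)=q\overline q=q_0^2+q_1^2-q_2^2-q_3^2$, $\mathrm{dv}(q)=q_1^2-q_2^2-q_3^2$. An element $q$ is singular (non-invertible) iff $\det(q)=0$. The quasi-similarity class of $q$ is $[\![q]\!]=\{p\in\mathbb{H}_{\rm coq}:\mathrm{Re}(p)=\mathrm{Re}(q),\ \mathrm{dv}(p)=\mathrm{dv}(q)\}$. $\mathbb{H}_{\rm coq}[x]$ is the ring of polynomials $\sum_i c_ix^i$ with coefficients $c_i\in\mathbb{H}_{\rm coq}$ on the left, with the usual addition and multiplication in which the variable $x$ commutes with the coefficients. The evaluation at $z\in\mathbb{H}_{\rm coq}$ is $P(z)=\sum_i c_iz^i$, and $z$ is a zero of $P$ if $P(z)=0$. The characteristic polynomial of $[\![q]\!]$ is the real polynomial $\Psi_{[\![q]\!]}(x)=(x-q)(x-\overline q)=x^2-2\mathrm{Re}(q)x+\det(q)$. The conjugate $\overline P$ of $P$ is obtained by conjugating all coefficients, and the companion polynomial of $P$ is $\mathcal C_P=P\overline P=\overline PP$,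 which has real coefficients. The class $[\![q]\!]$ is admissible for $P$ if $\Psi_{[\![q]\!]}$ divides $\mathcal C_P$. A zero $z$ of $P$ is isolated if $[\![z]\!]$ contains no other zeros of $P$; hyperboloidal if every element of $[\![z]\!]$ is a zero of $P$; linear if it is neither isolated nor hyperboloidal. All zeros of $P$ in the same quasi-similarity class are treated as forming a single zero, so that a whole class of zeros is called a hyperboloidal zero, and the set of zeros in a class, when it consists of linear zeros, is called a linear zero. *)

theory Defs
  imports Complex_Main "HOL-Library.Poly_Mapping"
begin

section \<open>Coquaternions\<close>

text \<open>\<open>Coquat a b c d\<close> stands for $a + b\,i + c\,j + d\,k$.\<close>

codatatype coquat = Coquat (q_re: real) (q_i: real) (q_j: real) (q_k: real)

lemma coquat_eq_iff:
  "x = y \<longleftrightarrow> q_re x = q_re y \<and> q_i x = q_i y \<and> q_j x = q_j y \<and> q_k x = q_k y"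
  by (auto intro: coquat.expand)

instantiation coquat :: ab_group_add
begin

primcorec zero_coquat where
  "q_re 0 = 0" | "q_i 0 = 0" | "q_j 0 = 0" | "q_k 0 = 0"

primcorec plus_coquat where
  "q_re (x + y) = q_re x + q_re y"
| "q_i (x + y) = q_i x + q_i y"
| "q_j (x + y) = q_j x + q_j y"
| "q_k (x + y) = q_k x + q_k y"

primcorec uminus_coquat where
  "q_re (- x) = - q_re x"
| "q_i (- x) = - q_i x"
| "q_j (- x) = - q_j x"
| "q_k (- x) = - q_k x"

primcorec minus_coquat where
  "q_re (x - y) = q_re x - q_re y"
| "q_i (x - y) = q_i x - q_i y"
| "q_j (x - y) = q_j x - q_j y"
| "q_k (x - y) = q_k x - q_k y"

instance
  by standard (simp_all add: coquat_eq_iff)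

end

instantiation coquat :: real_algebra_1
begin

primcorec one_coquat where
  "q_re 1 = 1" | "q_i 1 = 0" | "q_j 1 = 0" | "q_k 1 = 0"

text \<open>
  The bilinear extension of $i^2 = -1$, $j^2 = k^2 = 1$, $ij = -ji = k$; consequently
  $jk = -kj = -i$ and $ki = -ik = j$.
\<close>

primcorec times_coquat where
  "q_re (x * y) = q_re x * q_re y - q_i x * q_i y + q_j x * q_j y + q_k x * q_k y"
| "q_i (x * y) = q_re x * q_i y + q_i x * q_re y - q_j x * q_k y + q_k x * q_j y"
| "q_j (x * y) = q_re x * q_j y + q_j x * q_re y - q_i x * q_k y + q_k x * q_i y"
| "q_k (x * y) = q_re x * q_k y + q_k x * q_re y + q_i x * q_j y - q_j x * q_i y"

primcorec scaleR_coquat where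
  "q_re (scaleR r x) = r * q_re x"
| "q_i (scaleR r x) = r * q_i x"
| "q_j (scaleR r x) = r * q_j x"
| "q_k (scaleR r x) = r * q_k x"

instance
  by standard (simp_all add: coquat_eq_iff algebra_simps)

end

lemma coquat_units_mult:
  defines "i \<equiv> Coquat 0 1 0 0" and "j \<equiv> Coquat 0 0 1 0" and "k \<equiv> Coquat 0 0 0 1"
  shows "i * i = -1" "j * j = 1" "k * k = 1" "i * j = k" "j * i = - k"
  by (simp_all add: i_def j_def k_def coquat_eq_iff)

lemma of_real_coquat: "of_real r = Coquat r 0 0 0"
  by (simp add: of_real_def coquat_eq_iff)

definition q_cnj :: "coquat \<Rightarrow> coquat" where
  "q_cnj q = Coquat (q_re q) (- q_i q) (- q_j q) (- q_k q)"

definition q_det :: "coquat \<Rightarrow> real" where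
  "q_det q = (q_re q)\<^sup>2 + (q_i q)\<^sup>2 - (q_j q)\<^sup>2 - (q_k q)\<^sup>2"

definition q_dv :: "coquat \<Rightarrow> real" where
  "q_dv q = (q_i q)\<^sup>2 - (q_j q)\<^sup>2 - (q_k q)\<^sup>2"

definition q_singular :: "coquat \<Rightarrow> bool" where
  "q_singular q \<longleftrightarrow> \<not> (\<exists>p. p * q = 1 \<and> q * p = 1)"

lemma mult_q_cnj: "q * q_cnj q = of_real (q_det q)" "q_cnj q * q = of_real (q_det q)"
  by (simp_all add: q_cnj_def q_det_def of_real_coquat coquat_eq_iff power2_eq_square algebra_simps)

lemma q_det_mult: "q_det (p * q) = q_det p * q_det q"
  by (simp add: q_det_def power2_eq_square algebra_simps)

lemma q_singular_iff_det: "q_singular q \<longleftrightarrow> q_det q = 0"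
proof (cases "q_det q = 0")
  case True
  have "q_det (1::coquat) = 1"
    by (simp add: q_det_def)
  then have "p * q \<noteq> 1" for p
    using True q_det_mult[of p q] by auto
  then show ?thesis
    using True by (auto simp: q_singular_def)
next
  case False
  define p where "p = inverse (q_det q) *\<^sub>R q_cnj q"
  have "p * q = 1" "q * p = 1"
    using False by (simp_all add: p_def mult_q_cnj of_real_def)
  then show ?thesis
    using False by (auto simp: q_singular_def)
qed

definition qsim_class :: "coquat \<Rightarrow> coquat set" where
  "qsim_class q = {p. q_re p = q_re q \<and> q_dv p = q_dv q}"


section \<open>Polynomials over the coquaternions\<close>

text \<open>
  The library type \<open>'a poly\<close> carries a multiplication only over commutative coefficient rings.
  The finitely supported functions \<open>nat \<Rightarrow>\<^sub>0 coquat\<close>, with their convolution product, are the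
  ring of polynomials in a variable that commutes with the coefficients.
\<close>

type_synonym coqpoly = "nat \<Rightarrow>\<^sub>0 coquat"

definition Const :: "coquat \<Rightarrow> coqpoly" where
  "Const c = Poly_Mapping.single 0 c"

definition X :: coqpoly where
  "X = Poly_Mapping.single 1 1"

lemma X_commutes_Const: "X * Const c = Const c * X"
  by (simp add: X_def Const_def mult_single)

text \<open>\<open>Poly_Mapping.degree\<close> is one more than the usual degree, so it is avoided here.\<close>

definition monic_of_degree :: "nat \<Rightarrow> coqpoly \<Rightarrow> bool" where
  "monic_of_degree n P \<longleftrightarrow>
     Poly_Mapping.lookup P n = 1 \<and> (\<forall>m>n. Poly_Mapping.lookup P m = 0)"

definition eval :: "coqpoly \<Rightarrow> coquat \<Rightarrow> coquat" where
  "eval P z = (\<Sum>m\<in>Poly_Mapping.keys P. Poly_Mapping.lookup P m * z ^ m)"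

definition is_zero :: "coqpoly \<Rightarrow> coquat \<Rightarrow> bool" where
  "is_zero P z \<longleftrightarrow> eval P z = 0"

text \<open>The characteristic polynomial of the class of \<open>q\<close>.\<close>

definition char_poly :: "coquat \<Rightarrow> coqpoly" where
  "char_poly q = (X - Const q) * (X - Const (q_cnj q))"

lemma char_poly_eq:
  "char_poly q = X\<^sup>2 - Const (of_real (2 * q_re q)) * X + Const (of_real (q_det q))"
proof -
  have "q + q_cnj q = of_real (2 * q_re q)"
    by (simp only: of_real_coquat) (simp add: q_cnj_def coquat_eq_iff)
  then have "Const q + Const (q_cnj q) = Const (of_real (2 * q_re q))"
    by (metis Const_def single_add)
  moreover have "Const q * Const (q_cnj q) = Const (of_real (q_det q))"
    by (simp add: Const_def mult_single mult_q_cnj)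
  moreover have "char_poly q = X\<^sup>2 - (Const q + Const (q_cnj q)) * X + Const q * Const (q_cnj q)"
    by (simp add: char_poly_def algebra_simps power2_eq_square X_commutes_Const)
  ultimately show ?thesis
    by simp
qed

definition conj_poly :: "coqpoly \<Rightarrow> coqpoly" where
  "conj_poly P = Poly_Mapping.map q_cnj P"

definition companion_poly :: "coqpoly \<Rightarrow> coqpoly" where
  "companion_poly P = P * conj_poly P"

text \<open>
  Divisibility is that of the coquaternionic polynomial ring.  Since \<open>char_poly q\<close> is monic with
  real, hence central, coefficients, left, right and real divisibility of the real polynomial
  \<open>companion_poly P\<close> all agree.
\<close>

definition admissible :: "coqpoly \<Rightarrow> coquat \<Rightarrow> bool" where
  "admissible P q \<longleftrightarrow> (\<exists>K. companion_poly P = K * char_poly q)"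

definition zeros_in_class :: "coqpoly \<Rightarrow> coquat \<Rightarrow> coquat set" where
  "zeros_in_class P q = {z \<in> qsim_class q. is_zero P z}"

definition isolated_zero :: "coqpoly \<Rightarrow> coquat \<Rightarrow> bool" where
  "isolated_zero P z \<longleftrightarrow> is_zero P z \<and> (\<forall>w\<in>qsim_class z. is_zero P w \<longrightarrow> w = z)"

definition hyperboloidal_zero :: "coqpoly \<Rightarrow> coquat \<Rightarrow> bool" where
  "hyperboloidal_zero P z \<longleftrightarrow> is_zero P z \<and> (\<forall>w\<in>qsim_class z. is_zero P w)"

definition linear_zero :: "coqpoly \<Rightarrow> coquat \<Rightarrow> bool" where
  "linear_zero P z \<longleftrightarrow> is_zero P z \<and> \<not> isolated_zero P z \<and> \<not> hyperboloidal_zero P z"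

text \<open>
  Zeros in a common class count as a single zero, so the following are properties of the
  class of \<open>q\<close>.
\<close>

definition has_isolated_zero_in :: "coqpoly \<Rightarrow> coquat \<Rightarrow> bool" where
  "has_isolated_zero_in P q \<longleftrightarrow> (\<exists>z\<in>qsim_class q. isolated_zero P z)"

definition class_hyperboloidal_zero :: "coqpoly \<Rightarrow> coquat \<Rightarrow> bool" where
  "class_hyperboloidal_zero P q \<longleftrightarrow> (\<forall>z\<in>qsim_class q. hyperboloidal_zero P z)"

definition class_linear_zero :: "coqpoly \<Rightarrow> coquat \<Rightarrow> bool" where
  "class_linear_zero P q \<longleftrightarrow>
     zeros_in_class P q \<noteq> {} \<and> (\<forall>z\<in>zeros_in_class P q. linear_zero P z)"

end

theory Submission
  imports Defs
begin

text \<open>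
  The characteristic polynomial \<open>\<Psi>\<close> of a class is central and vanishes on the class, so a point
  \<open>z\<close> of the class is a zero of \<open>P\<close> iff \<open>A + B z = 0\<close>.  Evaluating the companion polynomial at a
  nonreal point of the class shows that admissibility forces \<open>(A + B x)(q_cnj A + q_cnj B x) = det B \<cdot> \<Psi>\<close>.
  For invertible \<open>B\<close> this places the root \<open>- B\<^sup>-\<^sup>1 A\<close> in the class.
  For singular \<open>B \<noteq> 0\<close>, write \<open>B = (b\<^sub>0 + b\<^sub>1 i)(1 - (k\<^sub>1 + k\<^sub>2 i) j)\<close> with \<open>k\<^sub>1\<^sup>2 + k\<^sub>2\<^sup>2 = 1\<close>; the right
  annihilator of \<open>B\<close> is then a plane parametrized by the \<open>1\<close>- and \<open>i\<close>-coordinates, and one intersects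
  its translate with the hyperboloid.
\<close>

text \<open>Reduces a claim that is additive in the polynomial to a check on monomials.\<close>

lemma poly_mapping_single_induct [case_names zero single_add]:
  fixes P :: "'a \<Rightarrow>\<^sub>0 'b::monoid_add"
  assumes "R 0" and "\<And>P k c. R P \<Longrightarrow> R (Poly_Mapping.single k c + P)"
  shows "R P"
proof (induction P rule: update_induct)
  case const
  show ?case by (rule assms)
next
  case (update f a b)
  have "Poly_Mapping.update a b f = Poly_Mapping.single a b + f"
    using update(1)
    by (intro poly_mapping_eqI)
      (auto simp: lookup_update lookup_add lookup_single when_def in_keys_iff)
  then show ?case using update assms by simp
qed

section \<open>Conjugation, and centrality of the characteristic polynomial\<close>

lemma of_real_coquat_commute: "of_real r * (z::coquat) = z * of_real r"
  by (simp add: of_real_def)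

lemma q_cnj_zero [simp]: "q_cnj 0 = 0"
  by (simp add: q_cnj_def coquat_eq_iff)

lemma q_cnj_add: "q_cnj (x + y) = q_cnj x + q_cnj y"
  by (simp add: q_cnj_def coquat_eq_iff)

lemma q_cnj_mult_of_real: "q_cnj (x * of_real r) = q_cnj x * of_real r"
  by (simp add: q_cnj_def coquat_eq_iff of_real_coquat)

text \<open>Cayley-Hamilton: as a real 2x2 matrix, \<open>z\<close> has trace
  \<open>2 * q_re z\<close> and determinant \<open>q_det z\<close>.\<close>

lemma coquat_square: "(z::coquat)\<^sup>2 = of_real (2 * q_re z) * z - of_real (q_det z)"
  by (simp add: power2_eq_square of_real_coquat q_det_def coquat_eq_iff algebra_simps
      del: of_real_mult)

lemma q_det_eq_dv: "q_det z = (q_re z)\<^sup>2 + q_dv z"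
  by (simp add: q_det_def q_dv_def)

text \<open>This shape, with the leading 1 kept as \<open>of_real 1\<close>, lets the rules for
  monomials with real coefficient apply to all three terms alike.\<close>

lemma char_poly_single:
  "char_poly q = Poly_Mapping.single 2 (of_real 1) + Poly_Mapping.single 1 (of_real (- 2 * q_re q))
     + Poly_Mapping.single 0 (of_real (q_det q))"
proof -
  have "X\<^sup>2 = Poly_Mapping.single 2 (1::coquat)"
    by (simp add: X_def power2_eq_square mult_single numeral_2_eq_2)
  moreover have "Const (of_real (2 * q_re q)) * X = Poly_Mapping.single 1 (of_real (2 * q_re q))"
    by (simp add: X_def Const_def mult_single)
  moreover have "\<dots> = - Poly_Mapping.single 1 (of_real (- 2 * q_re q))"
    by (simp flip: single_uminus)
  ultimately show ?thesis
    by (simp add: char_poly_eq Const_def)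
qed

lemma single_of_real_commute:
  "Poly_Mapping.single k (of_real r) * P = P * Poly_Mapping.single k (of_real r)" for P :: coqpoly
  by (induction P rule: poly_mapping_single_induct)
    (simp_all add: algebra_simps mult_single of_real_coquat_commute)

lemma char_poly_commute: "char_poly q * P = P * char_poly q"
  by (simp only: char_poly_single distrib_left distrib_right single_of_real_commute)

lemma lookup_conj_poly: "Poly_Mapping.lookup (conj_poly P) m = q_cnj (Poly_Mapping.lookup P m)"
  by (simp add: conj_poly_def Poly_Mapping.map.rep_eq when_def)

lemma conj_poly_zero [simp]: "conj_poly 0 = 0"
  by (rule poly_mapping_eqI) (simp add: lookup_conj_poly)

lemma conj_poly_add: "conj_poly (P + R) = conj_poly P + conj_poly R"
  by (rule poly_mapping_eqI) (simp add: lookup_conj_poly lookup_add q_cnj_add)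

lemma conj_poly_single: "conj_poly (Poly_Mapping.single k c) = Poly_Mapping.single k (q_cnj c)"
  by (rule poly_mapping_eqI) (simp add: lookup_conj_poly lookup_single when_def)

text \<open>Conjugation reverses products in general; a real, hence central, factor makes the order
  immaterial.\<close>

lemma conj_poly_mult_single_of_real:
  "conj_poly (P * Poly_Mapping.single k (of_real r)) = conj_poly P * Poly_Mapping.single k (of_real r)"
  by (induction P rule: poly_mapping_single_induct)
    (simp_all add: distrib_right conj_poly_add conj_poly_single mult_single q_cnj_mult_of_real)

lemma conj_poly_mult_char_poly: "conj_poly (P * char_poly q) = conj_poly P * char_poly q"
  by (simp only: char_poly_single distrib_left conj_poly_add conj_poly_mult_single_of_real)

section \<open>Evaluation of polynomials\<close>

lemma eval_superset:
  assumes "finite S" "Poly_Mapping.keys P \<subseteq> S"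
  shows "eval P z = (\<Sum>m\<in>S. Poly_Mapping.lookup P m * z ^ m)"
  unfolding eval_def using assms
  by (intro sum.mono_neutral_left) (auto simp: in_keys_iff)

lemma eval_zero [simp]: "eval 0 z = 0"
  by (simp add: eval_def)

lemma eval_add: "eval (P + R) z = eval P z + eval R z"
proof -
  let ?S = "Poly_Mapping.keys P \<union> Poly_Mapping.keys R"
  have "eval T z = (\<Sum>m\<in>?S. Poly_Mapping.lookup T m * z ^ m)" if "T \<in> {P, R, P + R}" for T
    using that keys_add[of P R] by (intro eval_superset) auto
  then show ?thesis
    by (simp add: lookup_add distrib_right sum.distrib)
qed

lemma eval_single: "eval (Poly_Mapping.single k c) z = c * z ^ k"
  by (subst eval_superset[of "{k}"]) auto

text \<open>Evaluation is not multiplicative over noncommuting coefficients; here it is, because the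
  real coefficient \<open>r\<close> moves past the powers of \<open>z\<close>.\<close>

lemma eval_mult_single_of_real:
  "eval (P * Poly_Mapping.single k (of_real r)) z = eval P z * (z ^ k * of_real r)"
proof (induction P rule: poly_mapping_single_induct)
  case (single_add P m c)
  have "c * of_real r * z ^ (m + k) = c * z ^ m * (z ^ k * of_real r)"
    by (simp add: power_add mult.assoc of_real_coquat_commute)
  with single_add show ?case
    by (simp add: distrib_right eval_add eval_single mult_single)
qed simp

text \<open>Real part and determinant are constant on the class, so each member is a root of
  \<open>char_poly q\<close> by Cayley-Hamilton.\<close>

lemma eval_mult_char_poly:
  assumes "z \<in> qsim_class q"
  shows "eval (P * char_poly q) z = 0"
proof -
  have "q_re z = q_re q" "q_det z = q_det q"
    using assms by (simp_all add: qsim_class_def q_det_eq_dv)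
  then have "z\<^sup>2 = z * of_real (2 * q_re q) - of_real (q_det q)"
    using coquat_square[of z] by (simp only: of_real_coquat_commute)
  then have "z ^ 2 * of_real 1 + z ^ 1 * of_real (- 2 * q_re q) + z ^ 0 * of_real (q_det q) = 0"
    by simp
  moreover have "eval (P * char_poly q) z = eval P z *
      (z ^ 2 * of_real 1 + z ^ 1 * of_real (- 2 * q_re q) + z ^ 0 * of_real (q_det q))"
    by (simp only: char_poly_single distrib_left eval_add eval_mult_single_of_real)
  ultimately show ?thesis
    by simp
qed

lemma linear_poly_single: "Const A + Const B * X = Poly_Mapping.single 0 A + Poly_Mapping.single 1 B"
  by (simp add: Const_def X_def mult_single)

lemma zeros_in_class_remainder:
  assumes "P = Q * char_poly q + (Const A + Const B * X)"
  shows "zeros_in_class P q = {z \<in> qsim_class q. A + B * z = 0}"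
  by (auto simp: zeros_in_class_def is_zero_def assms linear_poly_single eval_add eval_single
      eval_mult_char_poly)

section \<open>Constraints that admissibility puts on the remainder\<close>

lemma qsim_class_eq: "z \<in> qsim_class q \<Longrightarrow> qsim_class z = qsim_class q"
  by (simp add: qsim_class_def)

lemma qsim_class_obtain_nonreal:
  obtains z where "z \<in> qsim_class q" "q_i z \<noteq> 0"
proof
  \<comment> \<open>With zero k-coordinate the j-coordinate must square to
    \<open>t\<^sup>2 - q_dv q\<close>. The choice of \<open>t\<close> gives \<open>t \<ge> 1\<close>
    and \<open>t \<ge> q_dv q\<close>, so \<open>t\<^sup>2 \<ge> t\<close> keeps the root
    real.\<close>
  define t where "t = \<bar>q_dv q\<bar> + 1"
  let ?z = "Coquat (q_re q) t (sqrt (t\<^sup>2 - q_dv q)) 0"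
  have "t \<ge> 1" "q_dv q \<le> t"
    by (simp_all add: t_def)
  then have "t * 1 \<le> t * t"
    by (intro mult_left_mono) auto
  then have "t\<^sup>2 - q_dv q \<ge> 0"
    using \<open>q_dv q \<le> t\<close> by (simp add: power2_eq_square)
  then show "?z \<in> qsim_class q"
    by (simp add: qsim_class_def q_dv_def)
  show "q_i ?z \<noteq> 0"
    using \<open>t \<ge> 1\<close> by simp
qed

lemma admissible_remainder:
  assumes "admissible P q"
    and P: "P = Q * char_poly q + (Const A + Const B * X)"
  shows "q_det A = q_det B * q_det q"
    and "A * q_cnj B + B * q_cnj A = of_real (- 2 * q_re q * q_det B)"
proof -
  define R :: coqpoly where "R = Poly_Mapping.single 0 A + Poly_Mapping.single 1 B"
  \<comment> \<open>The mixed coefficient of \<open>R * conj_poly R\<close> is an element plus its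
    conjugate, hence real.\<close>
  define s where "s = 2 * q_re (A * q_cnj B)"
  have s: "A * q_cnj B + B * q_cnj A = of_real s"
    by (simp add: s_def q_cnj_def of_real_coquat coquat_eq_iff algebra_simps del: of_real_mult)
  obtain K where K: "companion_poly P = K * char_poly q"
    using assms(1) by (auto simp: admissible_def)
  obtain z where z: "z \<in> qsim_class q" "q_i z \<noteq> 0"
    by (rule qsim_class_obtain_nonreal)
  have PR: "P = Q * char_poly q + R"
    by (simp add: P linear_poly_single R_def)
  have "conj_poly P = conj_poly Q * char_poly q + conj_poly R"
    by (simp add: PR conj_poly_add conj_poly_mult_char_poly)
  then have "R * conj_poly P = R * conj_poly Q * char_poly q + R * conj_poly R"
    by (simp add: distrib_left mult.assoc)
  moreover have "companion_poly P = Q * (char_poly q * conj_poly P) + R * conj_poly P"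
    unfolding companion_poly_def by (subst (1) PR) (simp add: distrib_right mult.assoc)
  \<comment> \<open>Centrality of \<open>char_poly q\<close> collects both multiples of it, so the
    companion polynomial is congruent to \<open>R * conj_poly R\<close>.\<close>
  ultimately have "companion_poly P =
      (Q * conj_poly P + R * conj_poly Q) * char_poly q + R * conj_poly R"
    by (simp add: char_poly_commute distrib_right mult.assoc add.assoc)
  then have "eval (R * conj_poly R) z = 0"
    using eval_mult_char_poly[OF z(1)] by (metis K add_0 eval_add)
  moreover have "R * conj_poly R = Poly_Mapping.single 0 (A * q_cnj A)
      + Poly_Mapping.single 1 (A * q_cnj B + B * q_cnj A) + Poly_Mapping.single 2 (B * q_cnj B)"
    by (simp add: R_def conj_poly_add conj_poly_single distrib_left distrib_right mult_single
        single_add numeral_2_eq_2 add.assoc)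
  ultimately have "of_real (q_det A) + of_real s * z + of_real (q_det B) * z\<^sup>2 = 0"
    by (simp add: eval_add eval_single s mult_q_cnj)
  moreover have "q_re z = q_re q" "q_det z = q_det q"
    using z by (simp_all add: qsim_class_def q_det_eq_dv)
  ultimately have "of_real (q_det A - q_det B * q_det q) + of_real (s + 2 * q_re q * q_det B) * z = 0"
    using coquat_square[of z] by (simp add: of_real_def algebra_simps)
  \<comment> \<open>After the reduction of \<open>z\<^sup>2\<close>, a real linear expression in
    \<open>z\<close> vanishes. Its i-coordinate is the slope times \<open>q_i z\<close>, which is
    nonzero, so the slope vanishes and then the constant term.\<close>
  then have "s + 2 * q_re q * q_det B = 0" "q_det A - q_det B * q_det q = 0"
    using z(2) by (auto simp: coquat_eq_iff of_real_coquat simp del: of_real_add of_real_mult of_real_diff)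
  then have "s = - 2 * q_re q * q_det B" "q_det A = q_det B * q_det q"
    by linarith+
  then show "q_det A = q_det B * q_det q"
    "A * q_cnj B + B * q_cnj A = of_real (- 2 * q_re q * q_det B)"
    using s by simp_all
qed

section \<open>Invertible \<open>B\<close>\<close>

lemma nonsingular_linear_root:
  assumes "q_det B \<noteq> 0"
  shows "A + B * z = 0 \<longleftrightarrow> z = - ((q_cnj B * A) /\<^sub>R q_det B)"
proof
  assume "A + B * z = 0"
  then have "A = - (B * z)"
    by (simp add: add_eq_0_iff2)
  then have "q_cnj B * A = - (q_det B *\<^sub>R z)"
    by (simp add: mult_q_cnj of_real_def flip: mult.assoc)
  then show "z = - ((q_cnj B * A) /\<^sub>R q_det B)"
    using assms by simp
next
  assume "z = - ((q_cnj B * A) /\<^sub>R q_det B)"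
  then show "A + B * z = 0"
    using assms by (simp add: mult_q_cnj of_real_def flip: mult.assoc)
qed

text \<open>The determinant of the root comes from multiplicativity, its real part from the mixed
  coefficient; together they fix \<open>q_dv\<close>.\<close>

lemma nonsingular_root_in_class:
  assumes "q_det B \<noteq> 0" "q_det A = q_det B * q_det q"
    and "A * q_cnj B + B * q_cnj A = of_real (- 2 * q_re q * q_det B)"
  shows "- ((q_cnj B * A) /\<^sub>R q_det B) \<in> qsim_class q"
proof -
  define z where "z = - ((q_cnj B * A) /\<^sub>R q_det B)"
  have "B * z = - A"
    using nonsingular_linear_root[OF assms(1), of A z] by (simp add: z_def add_eq_0_iff)
  then have "q_det B * q_det z = q_det (- A)"
    by (simp flip: q_det_mult)
  also have "\<dots> = q_det B * q_det q"
    using assms(2) by (simp add: q_det_def)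
  finally have "q_det z = q_det q"
    using assms(1) by simp
  \<comment> \<open>The two summands are conjugate, so they share their real part, and
    \<open>q_re\<close> is invariant under swapping factors.\<close>
  moreover have "q_re (A * q_cnj B + B * q_cnj A) = 2 * q_re (q_cnj B * A)"
    by (simp add: q_cnj_def algebra_simps)
  then have "q_re (q_cnj B * A) = - q_re q * q_det B"
    unfolding assms(3) by (simp add: of_real_coquat del: of_real_mult of_real_minus)
  then have "q_re z = q_re q"
    using assms(1) by (simp add: z_def)
  ultimately show ?thesis
    unfolding z_def[symmetric] by (simp add: qsim_class_def q_det_eq_dv)
qed

section \<open>From zero sets to types of zeros\<close>

lemma unique_zero_isolated:
  assumes "zeros_in_class P q = {z}"
  shows "has_isolated_zero_in P q"
proof -
  have z: "z \<in> qsim_class q" "is_zero P z"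
    using assms by (auto simp: zeros_in_class_def)
  have "w = z" if "w \<in> qsim_class q" "is_zero P w" for w
    using that assms by (auto simp: zeros_in_class_def)
  then have "isolated_zero P z"
    unfolding isolated_zero_def qsim_class_eq[OF z(1)] using z(2) by blast
  then show ?thesis
    using z(1) by (auto simp: has_isolated_zero_in_def)
qed

lemma class_hyperboloidal_zeroI:
  assumes "zeros_in_class P q = qsim_class q"
  shows "class_hyperboloidal_zero P q"
proof -
  have "is_zero P w" if "w \<in> qsim_class q" for w
    using that assms by (auto simp: zeros_in_class_def)
  then show ?thesis
    by (simp add: class_hyperboloidal_zero_def hyperboloidal_zero_def qsim_class_eq)
qed

text \<open>Two distinct zeros exclude isolation, and a member of the class that is not a zero
  excludes the hyperboloidal type.\<close>

lemma class_linear_zeroI: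
  assumes "x \<in> zeros_in_class P q" "y \<in> zeros_in_class P q" "x \<noteq> y"
    and "w \<in> qsim_class q" "w \<notin> zeros_in_class P q"
  shows "class_linear_zero P q"
proof -
  have "linear_zero P z" if "z \<in> zeros_in_class P q" for z
  proof -
    have "z \<in> qsim_class q" "is_zero P z"
      using that by (auto simp: zeros_in_class_def)
    moreover have "\<not> isolated_zero P z"
      using assms(1-3) \<open>z \<in> qsim_class q\<close>
      by (auto simp: isolated_zero_def zeros_in_class_def qsim_class_eq)
    moreover have "\<not> hyperboloidal_zero P z"
      using assms(4,5) \<open>z \<in> qsim_class q\<close>
      by (auto simp: hyperboloidal_zero_def zeros_in_class_def qsim_class_eq)
    ultimately show ?thesis
      by (simp add: linear_zero_def)
  qed
  then show ?thesis
    using assms(1) by (auto simp: class_linear_zero_def)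
qed

section \<open>Singular nonzero \<open>B\<close>\<close>

lemma singular_factors:
  fixes b0 b1 b2 b3 :: real
  assumes "Coquat b0 b1 b2 b3 \<noteq> 0" "q_det (Coquat b0 b1 b2 b3) = 0"
    and k1: "k1 = - ((b0 * b2 + b1 * b3) / (b0\<^sup>2 + b1\<^sup>2))"
    and k2: "k2 = (b1 * b2 - b0 * b3) / (b0\<^sup>2 + b1\<^sup>2)"
  shows "b0\<^sup>2 + b1\<^sup>2 \<noteq> 0" "k1\<^sup>2 + k2\<^sup>2 = 1" "b2 = b1 * k2 - b0 * k1" "b3 = - (b0 * k2 + b1 * k1)"
proof -
  \<comment> \<open>Write \<open>B\<close> as c + d j with complex c = b0 + b1 i and d = b2 + b3 i.
    Singularity says that c and d have the same squared modulus \<open>N\<close>, and k1 + k2 i =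
    -d/c is then unimodular.\<close>
  define N where "N = b0\<^sup>2 + b1\<^sup>2"
  have N': "N = b2\<^sup>2 + b3\<^sup>2"
    using assms(2) by (simp add: N_def q_det_def)
  have "N \<noteq> 0"
  proof
    assume "N = 0"
    then have "b0 = 0" "b1 = 0" "b2 = 0" "b3 = 0"
      using N' by (simp_all add: N_def sum_power2_eq_zero_iff)
    with assms(1) show False by (simp add: coquat_eq_iff)
  qed
  have 1: "N * k1 = - (b0 * b2 + b1 * b3)" and 2: "N * k2 = b1 * b2 - b0 * b3"
    using \<open>N \<noteq> 0\<close> unfolding k1 k2 N_def[symmetric] by simp_all
  show "b0\<^sup>2 + b1\<^sup>2 \<noteq> 0"
    using \<open>N \<noteq> 0\<close> by (simp add: N_def)
  have "N * N * (k1\<^sup>2 + k2\<^sup>2) = (N * k1)\<^sup>2 + (N * k2)\<^sup>2"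
    by algebra
  \<comment> \<open>Two-square identity: the squared modulus is multiplicative.\<close>
  also have "\<dots> = (b0\<^sup>2 + b1\<^sup>2) * (b2\<^sup>2 + b3\<^sup>2)"
    unfolding 1 2 by algebra
  also have "\<dots> = N * N"
    using N' by (simp add: N_def)
  finally show "k1\<^sup>2 + k2\<^sup>2 = 1"
    using \<open>N \<noteq> 0\<close> by simp
  have "N * (b1 * k2 - b0 * k1) = b1 * (N * k2) - b0 * (N * k1)"
    by algebra
  also have "\<dots> = N * b2"
    unfolding 1 2 unfolding N_def by algebra
  finally show "b2 = b1 * k2 - b0 * k1"
    using \<open>N \<noteq> 0\<close> by simp
  have "N * (- (b0 * k2 + b1 * k1)) = - (b0 * (N * k2)) - b1 * (N * k1)"
    by algebra
  also have "\<dots> = N * b3"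
    unfolding 1 2 unfolding N_def by algebra
  finally show "b3 = - (b0 * k2 + b1 * k1)"
    using \<open>N \<noteq> 0\<close> by simp
qed

text \<open>Write w = a + b j with a, b complex and let k = k1 + k2 i. Once the complex factor b0 +
  b1 i is cancelled, the j-part of the product vanishes iff b is k times the conjugate of a; the
  complex part then vanishes too, as k has modulus 1.\<close>

lemma singular_annihilator:
  fixes b0 b1 k1 k2 :: real
  assumes "b0\<^sup>2 + b1\<^sup>2 \<noteq> 0" "k1\<^sup>2 + k2\<^sup>2 = 1"
  shows "Coquat b0 b1 (b1 * k2 - b0 * k1) (- (b0 * k2 + b1 * k1)) * w = 0 \<longleftrightarrow>
    q_j w = k2 * q_i w + k1 * q_re w \<and> q_k w = - k1 * q_i w + k2 * q_re w"
    (is "?B * w = 0 \<longleftrightarrow> ?R")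
proof
  assume w: "?B * w = 0"
  have j: "q_j (?B * w) = 0" and k: "q_k (?B * w) = 0"
    unfolding w by simp_all
  \<comment> \<open>These combinations of \<open>j\<close> and \<open>k\<close> amount to
    multiplying by b0 - b1 i from the left.\<close>
  have "(b0\<^sup>2 + b1\<^sup>2) * (q_j w - (k2 * q_i w + k1 * q_re w)) = 0"
    "(b0\<^sup>2 + b1\<^sup>2) * (q_k w - (- k1 * q_i w + k2 * q_re w)) = 0"
    using j k unfolding times_coquat.sel coquat.sel by algebra+
  then have "q_j w - (k2 * q_i w + k1 * q_re w) = 0" "q_k w - (- k1 * q_i w + k2 * q_re w) = 0"
    using assms(1) unfolding mult_eq_0_iff by blast+
  then show ?R
    by simp
next
  assume ?R
  then show "?B * w = 0"
    using assms(2) unfolding coquat_eq_iff times_coquat.sel coquat.sel zero_coquat.sel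
    by algebra
qed

lemma singular_linear_roots:
  assumes "A + B * g = 0"
    and "\<And>w. B * w = 0 \<longleftrightarrow>
      q_j w = k2 * q_i w + k1 * q_re w \<and> q_k w = - k1 * q_i w + k2 * q_re w"
  shows "A + B * z = 0 \<longleftrightarrow>
    q_j z = q_j g + k2 * (q_i z - q_i g) + k1 * (q_re z - q_re g) \<and>
    q_k z = q_k g - k1 * (q_i z - q_i g) + k2 * (q_re z - q_re g)"
proof -
  have "A + B * z = B * (z - g)"
    using assms(1) by (simp add: right_diff_distrib eq_neg_iff_add_eq_0[symmetric])
  then have "A + B * z = 0 \<longleftrightarrow> B * (z - g) = 0"
    by simp
  then show ?thesis
    unfolding assms(2) by (auto simp: algebra_simps)
qed

section \<open>The classification by \<open>A\<close> and \<open>B\<close>\<close>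

theorem theorem3p14:
  fixes P Q :: coqpoly and q A B :: coquat and n :: nat
    and q0 b0 b1 b2 b3 k1 k2 :: real
  assumes "monic_of_degree n P" and "n \<ge> 2"
    and "admissible P q"
    and "P = Q * char_poly q + (Const A + Const B * X)"
    and "q0 = q_re q"
    and "B = Coquat b0 b1 b2 b3"
    and "k1 = - ((b0 * b2 + b1 * b3) / (b0\<^sup>2 + b1\<^sup>2))"
    and "k2 = (b1 * b2 - b0 * b3) / (b0\<^sup>2 + b1\<^sup>2)"
  shows
    "(\<not> q_singular B \<longrightarrow>
        has_isolated_zero_in P q \<and>
        zeros_in_class P q = {- ((q_cnj B * A) /\<^sub>R q_det B)}) \<and>
     (B = 0 \<longrightarrow>
        (A \<noteq> 0 \<longrightarrow> zeros_in_class P q = {}) \<and>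
        (A = 0 \<longrightarrow> zeros_in_class P q = qsim_class q \<and> class_hyperboloidal_zero P q)) \<and>
     (B \<noteq> 0 \<and> q_singular B \<longrightarrow>
        ((\<nexists>x. A + B * x = 0) \<longrightarrow> zeros_in_class P q = {}) \<and>
        (\<forall>\<gamma>0::real. A + B * of_real \<gamma>0 = 0 \<longrightarrow>
           ((q0 - \<gamma>0)\<^sup>2 = - q_dv q \<longrightarrow>
              zeros_in_class P q =
                {Coquat q0 \<beta> (k2 * \<beta> + k1 * (q0 - \<gamma>0)) (- k1 * \<beta> + k2 * (q0 - \<gamma>0)) |\<beta>. True} \<and>
              class_linear_zero P q) \<and>
           ((q0 - \<gamma>0)\<^sup>2 \<noteq> - q_dv q \<longrightarrow> zeros_in_class P q = {})) \<and>
        (\<forall>\<gamma>0 \<gamma>1 :: real. \<gamma>1 \<noteq> 0 \<and> A + B * Coquat \<gamma>0 \<gamma>1 0 0 = 0 \<longrightarrow>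
           has_isolated_zero_in P q \<and>
           (let \<beta> = (q_dv q + (q0 - \<gamma>0)\<^sup>2 - \<gamma>1\<^sup>2) / (2 * \<gamma>1) in
              zeros_in_class P q =
                {Coquat q0 (\<beta> + \<gamma>1) (k2 * \<beta> + k1 * (q0 - \<gamma>0)) (- k1 * \<beta> + k2 * (q0 - \<gamma>0))}))) \<and>
     (\<not> q_singular B \<or>
      B = 0 \<or>
      B \<noteq> 0 \<and> q_singular B \<and>
        ((\<nexists>x. A + B * x = 0) \<or>
         (\<exists>\<gamma>0::real. A + B * of_real \<gamma>0 = 0) \<or>
         (\<exists>\<gamma>0 \<gamma>1 :: real. \<gamma>1 \<noteq> 0 \<and> A + B * Coquat \<gamma>0 \<gamma>1 0 0 = 0)))"
proof -
  have zeros: "zeros_in_class P q = {z \<in> qsim_class q. A + B * z = 0}"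
    using assms(4) by (rule zeros_in_class_remainder)
  have nonsingular: "has_isolated_zero_in P q \<and>
      zeros_in_class P q = {- ((q_cnj B * A) /\<^sub>R q_det B)}" if "\<not> q_singular B"
  proof -
    have B: "q_det B \<noteq> 0"
      using that by (simp add: q_singular_iff_det)
    have "zeros_in_class P q = {- ((q_cnj B * A) /\<^sub>R q_det B)}"
      using nonsingular_root_in_class[OF B admissible_remainder[OF assms(3,4)]]
      by (auto simp: zeros nonsingular_linear_root[OF B])
    then show ?thesis
      using unique_zero_isolated by blast
  qed
  have null: "A = 0 \<Longrightarrow> zeros_in_class P q = qsim_class q \<and> class_hyperboloidal_zero P q"
    "A \<noteq> 0 \<Longrightarrow> zeros_in_class P q = {}" if "B = 0"
    using that by (auto simp: zeros intro: class_hyperboloidal_zeroI)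
  have roots: "A + B * z = 0 \<longleftrightarrow>
      q_j z = q_j g + k2 * (q_i z - q_i g) + k1 * (q_re z - q_re g) \<and>
      q_k z = q_k g - k1 * (q_i z - q_i g) + k2 * (q_re z - q_re g)"
    and k: "k1\<^sup>2 + k2\<^sup>2 = 1"
    if "B \<noteq> 0" "q_singular B" "A + B * g = 0" for g z
  proof -
    have "q_det B = 0"
      using that(2) by (simp add: q_singular_iff_det)
    note f = singular_factors[OF that(1)[unfolded assms(6)] this[unfolded assms(6)] assms(7,8)]
    show "k1\<^sup>2 + k2\<^sup>2 = 1"
      by (rule f)
    show "A + B * z = 0 \<longleftrightarrow>
      q_j z = q_j g + k2 * (q_i z - q_i g) + k1 * (q_re z - q_re g) \<and>
      q_k z = q_k g - k1 * (q_i z - q_i g) + k2 * (q_re z - q_re g)"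
      using that(3) singular_annihilator[OF f(1,2)] f(3,4) unfolding assms(6)
      by (intro singular_linear_roots) simp_all
  qed
  \<comment> \<open>The real case is the instance \<open>\<gamma>1 = 0\<close>, for which the condition on \<open>\<beta>\<close> no longer involves \<open>\<beta>\<close>.\<close>
  have mem: "z \<in> zeros_in_class P q \<longleftrightarrow> (\<exists>\<beta>. q_dv q = 2 * \<beta> * \<gamma>1 + \<gamma>1\<^sup>2 - (q0 - \<gamma>0)\<^sup>2 \<and>
      z = Coquat q0 (\<beta> + \<gamma>1) (k2 * \<beta> + k1 * (q0 - \<gamma>0)) (- k1 * \<beta> + k2 * (q0 - \<gamma>0)))"
    (is "_ \<longleftrightarrow> (\<exists>\<beta>. _ \<and> z = ?z \<beta>)")
    if B: "B \<noteq> 0" "q_singular B" and g: "A + B * Coquat \<gamma>0 \<gamma>1 0 0 = 0" for \<gamma>0 \<gamma>1 z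
  proof -
    have "z \<in> zeros_in_class P q \<longleftrightarrow> q_dv z = q_dv q \<and> (\<exists>\<beta>. z = ?z \<beta>)"
    proof -
      \<comment> \<open>The parameter is the offset of the i-coordinate of \<open>z\<close> from
        that of the known root.\<close>
      have "q_re z = q0 \<and> A + B * z = 0 \<longleftrightarrow> z = ?z (q_i z - \<gamma>1)"
        unfolding roots[OF B g, of z] by (auto simp: coquat_eq_iff)
      also have "\<dots> \<longleftrightarrow> (\<exists>\<beta>. z = ?z \<beta>)"
      proof -
        have "\<beta> = q_i z - \<gamma>1" if "z = ?z \<beta>" for \<beta>
          using that by simp
        then show ?thesis
          by metis
      qed
      finally show ?thesis
        by (auto simp: zeros qsim_class_def assms(5))
    qed
    \<comment> \<open>The j- and k-coordinates arise from \<open>\<beta>\<close> and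
      \<open>q0 - \<gamma>0\<close> by an orthogonal map, so their squares sum to
      \<open>\<beta>\<^sup>2 + (q0 - \<gamma>0)\<^sup>2\<close>; the terms in
      \<open>\<beta>\<^sup>2\<close> cancel.\<close>
    moreover have "q_dv (?z \<beta>) = 2 * \<beta> * \<gamma>1 + \<gamma>1\<^sup>2 - (q0 - \<gamma>0)\<^sup>2" for \<beta>
      using k[OF B g] unfolding q_dv_def coquat.sel by algebra
    ultimately show ?thesis
      by metis
  qed
  have real_root: "((q0 - \<gamma>0)\<^sup>2 = - q_dv q \<longrightarrow>
        zeros_in_class P q =
          {Coquat q0 \<beta> (k2 * \<beta> + k1 * (q0 - \<gamma>0)) (- k1 * \<beta> + k2 * (q0 - \<gamma>0)) |\<beta>. True} \<and>
        class_linear_zero P q) \<and>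
      ((q0 - \<gamma>0)\<^sup>2 \<noteq> - q_dv q \<longrightarrow> zeros_in_class P q = {})"
    if B: "B \<noteq> 0" "q_singular B" and g: "A + B * of_real \<gamma>0 = 0" for \<gamma>0 :: real
  proof -
    let ?s = "q0 - \<gamma>0"
    let ?z = "\<lambda>\<beta>. Coquat q0 \<beta> (k2 * \<beta> + k1 * ?s) (- k1 * \<beta> + k2 * ?s)"
    have g': "A + B * Coquat \<gamma>0 0 0 0 = 0"
      using g by (simp add: of_real_coquat)
    have mem': "z \<in> zeros_in_class P q \<longleftrightarrow> q_dv q = - ?s\<^sup>2 \<and> (\<exists>\<beta>. z = ?z \<beta>)" for z
      using mem[OF B g', of z] by simp
    have "zeros_in_class P q = {?z \<beta> |\<beta>. True} \<and> class_linear_zero P q" if s: "?s\<^sup>2 = - q_dv q"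
    proof
      show Z: "zeros_in_class P q = {?z \<beta> |\<beta>. True}"
        using s by (auto simp: mem')
      \<comment> \<open>Flipping the signs of the j- and k-coordinates of \<open>?z 1\<close>
        preserves the class. The result could lie on the line only if both coordinates were 0, but
        their squares sum to \<open>1 + ?s\<^sup>2\<close>.\<close>
      let ?w = "Coquat q0 1 (- (k2 + k1 * ?s)) (- (- k1 + k2 * ?s))"
      have k: "k1\<^sup>2 + k2\<^sup>2 = 1"
        by (rule k[OF B g'])
      have w: "(k2 + k1 * ?s)\<^sup>2 + (- k1 + k2 * ?s)\<^sup>2 = 1 + ?s\<^sup>2"
        using k by algebra
      show "class_linear_zero P q"
      proof (rule class_linear_zeroI)
        show "?z 0 \<in> zeros_in_class P q" "?z 1 \<in> zeros_in_class P q" "?z 0 \<noteq> ?z 1"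
          unfolding Z by (auto simp: coquat_eq_iff)
        have "q_dv ?w = - ?s\<^sup>2"
          using w unfolding q_dv_def coquat.sel power2_minus by simp
        then show "?w \<in> qsim_class q"
          using s by (simp add: qsim_class_def assms(5))
        show "?w \<notin> zeros_in_class P q"
        proof
          assume "?w \<in> zeros_in_class P q"
          then have 0: "k2 + k1 * ?s = 0" "- k1 + k2 * ?s = 0"
            unfolding Z by (auto simp: coquat_eq_iff)
          show False
            using w zero_le_power2[of ?s] unfolding 0 by simp
        qed
      qed
    qed
    moreover have "zeros_in_class P q = {}" if "?s\<^sup>2 \<noteq> - q_dv q"
      using that mem' by fastforce
    ultimately show ?thesis
      by blast
  qed
  have complex_root: "has_isolated_zero_in P q \<and>
      (let \<beta> = (q_dv q + (q0 - \<gamma>0)\<^sup>2 - \<gamma>1\<^sup>2) / (2 * \<gamma>1) in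
         zeros_in_class P q =
           {Coquat q0 (\<beta> + \<gamma>1) (k2 * \<beta> + k1 * (q0 - \<gamma>0)) (- k1 * \<beta> + k2 * (q0 - \<gamma>0))})"
    if B: "B \<noteq> 0" "q_singular B" and g: "\<gamma>1 \<noteq> 0 \<and> A + B * Coquat \<gamma>0 \<gamma>1 0 0 = 0" for \<gamma>0 \<gamma>1
  proof -
    define \<beta>0 where "\<beta>0 = (q_dv q + (q0 - \<gamma>0)\<^sup>2 - \<gamma>1\<^sup>2) / (2 * \<gamma>1)"
    \<comment> \<open>Since \<open>\<gamma>1\<close> is nonzero, the class condition is a linear
      equation with exactly one solution.\<close>
    have "q_dv q = 2 * \<beta> * \<gamma>1 + \<gamma>1\<^sup>2 - (q0 - \<gamma>0)\<^sup>2 \<longleftrightarrow> \<beta> = \<beta>0" for \<beta>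
      using g unfolding \<beta>0_def by (auto simp: field_simps)
    then have "zeros_in_class P q =
        {Coquat q0 (\<beta>0 + \<gamma>1) (k2 * \<beta>0 + k1 * (q0 - \<gamma>0)) (- k1 * \<beta>0 + k2 * (q0 - \<gamma>0))}"
      by (intro set_eqI) (simp add: mem[OF B conjunct2[OF g]])
    then show ?thesis
      unfolding Let_def \<beta>0_def[symmetric] using unique_zero_isolated by blast
  qed
  have exhaustive: "(\<exists>\<gamma>0::real. A + B * of_real \<gamma>0 = 0) \<or>
      (\<exists>\<gamma>0 \<gamma>1 :: real. \<gamma>1 \<noteq> 0 \<and> A + B * Coquat \<gamma>0 \<gamma>1 0 0 = 0)"
    if B: "B \<noteq> 0" "q_singular B" and x: "A + B * x = 0" for x
  proof -
    \<comment> \<open>the element of the annihilator of \<open>B\<close> with the same \<open>j\<close>- and \<open>k\<close>-coordinates as \<open>x\<close>,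
      found by inverting the rotation with entries \<open>k1\<close>, \<open>k2\<close>\<close>
    define u where "u = k1 * q_j x + k2 * q_k x"
    define v where "v = k2 * q_j x - k1 * q_k x"
    have "A + B * Coquat (q_re x - u) (q_i x - v) 0 0 = 0"
      unfolding roots[OF B x] coquat.sel u_def v_def using k[OF B x] by algebra
    \<comment> \<open>This root has no j- or k-part; whether its i-coordinate vanishes decides
      between the real and the nonreal case.\<close>
    then show ?thesis
      unfolding of_real_coquat by metis
  qed
  show ?thesis
  proof (rule conjI[OF impI conjI[OF impI conjI[OF impI]]], goal_cases)
    case 1
    then show ?case by (rule nonsingular)
  next
    case 2
    then show ?case using null by blast
  next
    case 3
    then have B: "B \<noteq> 0" "q_singular B"
      by simp_all
    have "zeros_in_class P q = {}" if "\<nexists>x. A + B * x = 0"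
      using that by (auto simp: zeros)
    then show ?case
      using real_root[OF B] complex_root[OF B] by (intro conjI[OF impI conjI] allI[OF impI]) simp_all
  next
    case 4
    show ?case using exhaustive by blast
  qed
qed

end
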